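(* Let $T_5=\{(x,y)\in\mathbb{N}^2 : x+y\le 6\}$. Then $\mathrm{gon}(R(T_5))=10$.
   Context: $\mathbb{N}=\{1,2,3,\dots\}$. For a Ferrers diagram $F\subset\mathbb{N}^2$, the Ferrers rook graph $R(F)$ is the simple graph with vertex set $F$ in which distinct $(x,y),(x',y')$ are adjacent iff $x=x'$ or $y=y'$. Divisors on a graph: functions $D:V\to\mathbb{Z}$, degree $\sum_v D(v)$; firing a vertex $v$ means $v$ loses $\deg(v)$ chips and each neighbor gains one; divisors are equivalent if related by a sequence of firings; $\vert D\vert$ is the set of effective (nonnegative) divisors equivalent to $D$; $D$ has positive rank if for every vertex $v$ some $D'\in\vert D\vert$ has $D'(v)>0$. The gonality $\mathrm{gon}(G)$ is the minimum degree of a divisor on $G$ with positive rank. *)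

theory Defs
  imports Main
begin

(* A simple graph is given by a finite vertex set V and a symmetric irreflexive
   adjacency relation E (only its restriction to V matters). *)

definition rook_adj :: "nat \<times> nat \<Rightarrow> nat \<times> nat \<Rightarrow> bool" where
  "rook_adj p q \<longleftrightarrow> p \<noteq> q \<and> (fst p = fst q \<or> snd p = snd q)"

(* the staircase Ferrers diagram T_5, with N = {1,2,3,...} *)
definition T5 :: "(nat \<times> nat) set" where
  "T5 = {(x, y). 1 \<le> x \<and> 1 \<le> y \<and> x + y \<le> 6}"

definition vdeg :: "'a set \<Rightarrow> ('a \<Rightarrow> 'a \<Rightarrow> bool) \<Rightarrow> 'a \<Rightarrow> nat" where
  "vdeg V E v = card {w \<in> V. E v w}"

definition is_divisor :: "'a set \<Rightarrow> ('a \<Rightarrow> int) \<Rightarrow> bool" where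
  "is_divisor V D \<longleftrightarrow> (\<forall>u. u \<notin> V \<longrightarrow> D u = 0)"

definition div_degree :: "'a set \<Rightarrow> ('a \<Rightarrow> int) \<Rightarrow> int" where
  "div_degree V D = (\<Sum>v\<in>V. D v)"

definition fire :: "'a set \<Rightarrow> ('a \<Rightarrow> 'a \<Rightarrow> bool) \<Rightarrow> 'a \<Rightarrow> ('a \<Rightarrow> int) \<Rightarrow> ('a \<Rightarrow> int)" where
  "fire V E v D = (\<lambda>u. if u = v then D u - int (vdeg V E v)
                        else if u \<in> V \<and> E v u then D u + 1 else D u)"

definition div_equiv :: "'a set \<Rightarrow> ('a \<Rightarrow> 'a \<Rightarrow> bool) \<Rightarrow> ('a \<Rightarrow> int) \<Rightarrow> ('a \<Rightarrow> int) \<Rightarrow> bool" where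
  "div_equiv V E = (\<lambda>A B. \<exists>v\<in>V. B = fire V E v A)\<^sup>*\<^sup>*"

definition effective :: "'a set \<Rightarrow> ('a \<Rightarrow> int) \<Rightarrow> bool" where
  "effective V D \<longleftrightarrow> (\<forall>v\<in>V. D v \<ge> 0)"

definition positive_rank :: "'a set \<Rightarrow> ('a \<Rightarrow> 'a \<Rightarrow> bool) \<Rightarrow> ('a \<Rightarrow> int) \<Rightarrow> bool" where
  "positive_rank V E D \<longleftrightarrow>
     (\<forall>v\<in>V. \<exists>D'. div_equiv V E D D' \<and> effective V D' \<and> D' v > 0)"

definition gonality :: "'a set \<Rightarrow> ('a \<Rightarrow> 'a \<Rightarrow> bool) \<Rightarrow> int" where
  "gonality V E = (LEAST k::int. \<exists>D. is_divisor V D \<and> div_degree V D = k \<and> positive_rank V E D)"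

end

theory Submission
  imports Defs
begin

text \<open>
  Let \<open>q = (1,1)\<close>. Maximising \<open>5 D(q)\<close> plus the number of chips on the rest of the first row and
  column over the effective divisors of a class gives a \<open>q\<close>-reduced representative: every
  set that can legally be fired contains \<open>q\<close>. A legal firing set of a divisor of degree at most
  9 has at most 9 boundary edges, and then the set or its complement has at most 3 vertices.
  If \<open>D(q) < 8\<close> no legal set has at most 3 vertices; if \<open>D(q) \<ge> 8\<close> the same is true after firing
  \<open>q\<close>. In a class of positive rank every empty vertex then lies in a set \<open>W\<close> of at most 3 vertices
  such that each vertex outside \<open>W\<close> carries at least as many chips as it has neighbours in \<open>W\<close>.
  This forces at least 4, 3 and 2 chips on the first three columns and one more on the last two.
  The bound is attained by the divisor with \<open>4, 3, 2, 1, 0\<close> chips on the first column.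
\<close>

declare sum_of_bool_eq [simp del] sum_mult_of_bool_eq [simp del] sum_of_bool_mult_eq [simp del]

section \<open>Laplacian, firing scripts and legal firing sets\<close>

text \<open>The negative of the usual graph Laplacian: the net gain of \<open>u\<close> when every
  \<open>x\<close> fires \<open>f x\<close> times.\<close>

definition lap :: "'a set \<Rightarrow> ('a \<Rightarrow> 'a \<Rightarrow> bool) \<Rightarrow> ('a \<Rightarrow> int) \<Rightarrow> 'a \<Rightarrow> int" where
  "lap V E f u = (\<Sum>x\<in>V. of_bool (E u x) * (f x - f u))"

definition fire_script ::
  "'a set \<Rightarrow> ('a \<Rightarrow> 'a \<Rightarrow> bool) \<Rightarrow> ('a \<Rightarrow> int) \<Rightarrow> ('a \<Rightarrow> int) \<Rightarrow> 'a \<Rightarrow> int" where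
  "fire_script V E f D u = (if u \<in> V then D u + lap V E f u else D u)"

definition outdeg :: "'a set \<Rightarrow> ('a \<Rightarrow> 'a \<Rightarrow> bool) \<Rightarrow> 'a set \<Rightarrow> 'a \<Rightarrow> int" where
  "outdeg V E U u = (\<Sum>x\<in>V - U. of_bool (E u x))"

definition legal :: "'a set \<Rightarrow> ('a \<Rightarrow> 'a \<Rightarrow> bool) \<Rightarrow> 'a set \<Rightarrow> ('a \<Rightarrow> int) \<Rightarrow> bool" where
  "legal V E U D \<longleftrightarrow> U \<subseteq> V \<and> U \<noteq> {} \<and> (\<forall>u\<in>U. outdeg V E U u \<le> D u)"

lemma lap_add: "lap V E (\<lambda>x. f x + g x) u = lap V E f u + lap V E g u"
  unfolding lap_def sum.distrib[symmetric] by (rule sum.cong) (auto simp: algebra_simps)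

lemma lap_diff: "lap V E (\<lambda>x. f x - g x) u = lap V E f u - lap V E g u"
  unfolding lap_def sum_subtractf[symmetric] by (rule sum.cong) (auto simp: algebra_simps)

lemma fire_script_add:
  "fire_script V E f (fire_script V E g D) = fire_script V E (\<lambda>x. g x + f x) D"
  by (rule ext) (simp add: fire_script_def lap_add)

lemma fire_script_zero: "fire_script V E (\<lambda>_. 0) D = D"
  by (rule ext) (simp add: fire_script_def lap_def)

locale simple_graph =
  fixes V :: "'a set" and E :: "'a \<Rightarrow> 'a \<Rightarrow> bool"
  assumes finite_V [simp]: "finite V"
    and sym: "E u v \<Longrightarrow> E v u"
    and irrefl [simp]: "\<not> E v v"
begin

lemma fire_eq_fire_script:
  assumes "v \<in> V"
  shows "fire V E v D = fire_script V E (\<lambda>u. of_bool (u = v)) D"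
proof
  fix u
  show "fire V E v D u = fire_script V E (\<lambda>u. of_bool (u = v)) D u"
  proof (cases "u = v")
    case True
    have "lap V E (\<lambda>u. of_bool (u = v)) v = (\<Sum>x\<in>V. - of_bool (E v x))"
      unfolding lap_def by (rule sum.cong) auto
    also have "\<dots> = - int (vdeg V E v)"
      by (simp add: sum_negf of_bool_def sum.If_cases vdeg_def Int_def)
    finally show ?thesis
      using True assms by (simp add: fire_def fire_script_def)
  next
    case False
    have "lap V E (\<lambda>u. of_bool (u = v)) u = (\<Sum>x\<in>V. if x = v then of_bool (E u v) else 0)"
      unfolding lap_def using False by (intro sum.cong) auto
    also have "\<dots> = of_bool (E v u)"
      \<comment> \<open>\<open>fire\<close> tests \<open>E v u\<close>, the Laplacian
        \<open>E u v\<close>; symmetry matches them.\<close>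
      using assms sym by auto
    finally show ?thesis
      using False by (simp add: fire_def fire_script_def)
  qed
qed

lemma div_equiv_imp_fire_script:
  assumes "div_equiv V E D D'"
  obtains f where "D' = fire_script V E f D"
proof -
  have "\<exists>f. D' = fire_script V E f D"
    using assms unfolding div_equiv_def
  proof (induction rule: rtranclp_induct)
    case base
    show ?case using fire_script_zero by metis
  next
    case (step A B)
    then show ?case
      using fire_eq_fire_script fire_script_add by metis
  qed
  then show ?thesis using that by blast
qed

lemma div_equiv_fire: "div_equiv V E A B \<Longrightarrow> v \<in> V \<Longrightarrow> div_equiv V E A (fire V E v B)"
  unfolding div_equiv_def by (erule rtranclp.rtrancl_into_rtrancl) blast

text \<open>The vertices of \<open>U\<close> fire one by one; debts on the way are permitted in
  \<open>div_equiv\<close>.\<close>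

lemma div_equiv_fire_set:
  assumes "U \<subseteq> V"
  shows "div_equiv V E D (fire_script V E (\<lambda>u. of_bool (u \<in> U)) D)"
proof -
  have "finite U" using assms finite_V finite_subset by blast
  then show ?thesis
    using assms
  proof (induction U rule: finite_induct)
    case empty
    then show ?case by (simp add: div_equiv_def fire_script_zero)
  next
    case (insert v U)
    have "(\<lambda>u. of_bool (u \<in> insert v U) :: int) = (\<lambda>u. of_bool (u \<in> U) + of_bool (u = v))"
      using insert.hyps by auto
    then have "fire_script V E (\<lambda>u. of_bool (u \<in> insert v U)) D
        = fire V E v (fire_script V E (\<lambda>u. of_bool (u \<in> U)) D)"
      using insert.prems by (simp add: fire_eq_fire_script fire_script_add)
    then show ?case
      using insert.IH insert.prems by (simp add: div_equiv_fire)
  qed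
qed

lemma div_equiv_trans: "div_equiv V E A B \<Longrightarrow> div_equiv V E B C \<Longrightarrow> div_equiv V E A C"
  unfolding div_equiv_def by (rule rtranclp_trans)

text \<open>The off-diagonal parts agree after swapping the sums, by symmetry of \<open>E\<close>;
  the diagonal parts coincide.\<close>

lemma lap_self_adjoint: "(\<Sum>u\<in>V. p u * lap V E f u) = (\<Sum>u\<in>V. f u * lap V E p u)"
proof -
  define a where "a = (\<lambda>u x. of_bool (E u x) :: int)"
  have a: "a u x = a x u" for u x using sym by (auto simp: a_def)
  have "(\<Sum>u\<in>V. \<Sum>x\<in>V. a u x * (p u * f x)) = (\<Sum>u\<in>V. \<Sum>x\<in>V. a u x * (f u * p x))"
    by (subst sum.swap) (simp add: a mult.commute)
  moreover have "lap V E g = (\<lambda>u. \<Sum>x\<in>V. a u x * g x - a u x * g u)" for g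
    by (rule ext) (simp only: lap_def a_def right_diff_distrib)
  ultimately show ?thesis
    by (simp add: sum_distrib_left right_diff_distrib sum_subtractf mult_ac)
qed

text \<open>Shifting the Laplacian to the weight \<open>p\<close> shows how firing moves a weighted
  degree: constant weight 1 gives invariance of the degree, other weights give a potential.\<close>

lemma weighted_degree_fire_script:
  "(\<Sum>u\<in>V. p u * fire_script V E f D u) = (\<Sum>u\<in>V. p u * D u) + (\<Sum>u\<in>V. f u * lap V E p u)"
proof -
  have "(\<Sum>u\<in>V. p u * fire_script V E f D u) = (\<Sum>u\<in>V. p u * D u + p u * lap V E f u)"
    by (rule sum.cong) (auto simp: fire_script_def algebra_simps)
  then show ?thesis by (simp add: sum.distrib lap_self_adjoint[of p f])
qed

lemma degree_div_equiv:
  assumes "div_equiv V E D D'"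
  shows "div_degree V D' = div_degree V D"
proof -
  obtain f where "D' = fire_script V E f D" using assms div_equiv_imp_fire_script by blast
  then show ?thesis
    using weighted_degree_fire_script[of "\<lambda>_. 1" f D] by (simp add: div_degree_def lap_def)
qed

section \<open>Legal firing and reduced divisors\<close>

text \<open>A vertex of \<open>U\<close> loses its outdegree; a vertex outside \<open>U\<close> can
  only gain.\<close>

lemma effective_fire_legal:
  assumes "legal V E U D" "effective V D"
  shows "effective V (fire_script V E (\<lambda>u. of_bool (u \<in> U)) D)"
  unfolding effective_def
proof
  fix u assume u: "u \<in> V"
  show "0 \<le> fire_script V E (\<lambda>u. of_bool (u \<in> U)) D u"
  proof (cases "u \<in> U")
    case True
    have "lap V E (\<lambda>u. of_bool (u \<in> U)) u = (\<Sum>x\<in>V. if x \<in> V - U then - of_bool (E u x) else 0)"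
      unfolding lap_def using True by (intro sum.cong) auto
    also have "\<dots> = - outdeg V E U u"
      by (subst sum.inter_restrict[symmetric]) (auto simp: outdeg_def sum_negf Int_absorb1)
    finally show ?thesis using True u assms(1) by (auto simp: legal_def fire_script_def)
  next
    case False
    have "lap V E (\<lambda>u. of_bool (u \<in> U)) u \<ge> 0"
      unfolding lap_def using False by (intro sum_nonneg) auto
    then show ?thesis using u assms(2) by (simp add: effective_def fire_script_def)
  qed
qed

text \<open>The firing set is the set where the firing script from \<^term>\<open>D'\<close> to a divisor
  positive at \<^term>\<open>v\<close> attains its maximum; \<^term>\<open>v\<close> is not in it, because a maximum of the
  script cannot gain chips.\<close>

lemma positive_rank_imp_legal:
  assumes "positive_rank V E D" "div_equiv V E D D'" "v \<in> V" "D' v \<le> 0"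
  obtains U where "legal V E U D'" "v \<notin> U"
proof -
  obtain D'' where D'': "div_equiv V E D D''" "effective V D''" "D'' v > 0"
    using assms unfolding positive_rank_def by blast
  obtain f g where f: "D' = fire_script V E f D" and g: "D'' = fire_script V E g D"
    using assms(2) D''(1) div_equiv_imp_fire_script by metis
  define h where "h = (\<lambda>x. g x - f x)"
  have h: "D'' u = D' u + lap V E h u" if "u \<in> V" for u
    using that by (simp add: f g h_def fire_script_def lap_diff)
  define U where "U = {u \<in> V. \<forall>x\<in>V. h x \<le> h u}"
  have "Max (h ` V) \<in> h ` V" using assms(3) by (intro Max_in) auto
  then obtain m where m: "m \<in> V" "h m = Max (h ` V)" by fastforce
  have "m \<in> U" using m by (simp add: U_def)
  \<comment> \<open>The script is integer-valued, so a vertex outside \<open>U\<close> lies at least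
    1 below the maximum and each edge leaving \<open>U\<close> costs \<open>u\<close> at least one
    chip.\<close>
  have bound: "lap V E h u \<le> - outdeg V E U u" if "u \<in> U" for u
  proof -
    have "lap V E h u \<le> (\<Sum>x\<in>V. if x \<in> V - U then - of_bool (E u x) else 0)"
      unfolding lap_def
    proof (rule sum_mono)
      fix x assume x: "x \<in> V"
      have "h x \<le> h u" using that x by (simp add: U_def)
      moreover have "h x < h u" if "x \<notin> U"
        using that x \<open>u \<in> U\<close> unfolding U_def by force
      ultimately show "of_bool (E u x) * (h x - h u) \<le> (if x \<in> V - U then - of_bool (E u x) else 0)"
        using x by auto
    qed
    also have "\<dots> = - outdeg V E U u"
      by (subst sum.inter_restrict[symmetric]) (auto simp: outdeg_def sum_negf Int_absorb1)
    finally show ?thesis .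
  qed
  have UV: "U \<subseteq> V" by (auto simp: U_def)
  have "outdeg V E U u \<le> D' u" if "u \<in> U" for u
    using bound[OF that] h[of u] D''(2) UV that unfolding effective_def by fastforce
  then have "legal V E U D'" using UV \<open>m \<in> U\<close> by (auto simp: legal_def)
  moreover have "v \<notin> U"
  proof
    assume "v \<in> U"
    moreover have "outdeg V E U v \<ge> 0" unfolding outdeg_def by (rule sum_nonneg) auto
    ultimately show False using bound[of v] h[OF assms(3)] D''(3) assms(4) by linarith
  qed
  ultimately show ?thesis using that by blast
qed

text \<open>Firing a set that avoids \<^term>\<open>q\<close> increases the \<^term>\<open>p\<close>-weighted degree, so a
  maximiser of that degree admits no such firing.\<close>

lemma ex_reduced:
  assumes D0: "div_equiv V E D D0" "effective V D0"
    and p: "\<And>u. u \<in> V \<Longrightarrow> u \<noteq> q \<Longrightarrow> lap V E p u > 0"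
  obtains D' where "div_equiv V E D D'" "effective V D'" "\<And>U. legal V E U D' \<Longrightarrow> q \<in> U"
proof -
  define P where "P = (\<lambda>D. \<Sum>u\<in>V. p u * D u)"
  \<comment> \<open>An upper bound for \<open>P\<close> on the effective divisors of the class,
    since the degree is invariant; it turns maximising \<open>P\<close> into minimising the natural
    number \<open>B - P\<close>.\<close>
  define B where "B = (\<Sum>u\<in>V. \<bar>p u\<bar>) * div_degree V D"
  have bound: "P D' \<le> B" if "div_equiv V E D D'" "effective V D'" for D'
  proof -
    have "p u \<le> (\<Sum>u\<in>V. \<bar>p u\<bar>)" if "u \<in> V" for u
      using member_le_sum[of u V "\<lambda>u. \<bar>p u\<bar>"] that by fastforce
    then have "P D' \<le> (\<Sum>u\<in>V. (\<Sum>u\<in>V. \<bar>p u\<bar>) * D' u)"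
      unfolding P_def using that(2) by (intro sum_mono mult_right_mono) (auto simp: effective_def)
    also have "\<dots> = B"
      using degree_div_equiv[OF that(1)]
      by (simp add: B_def div_degree_def flip: sum_distrib_left)
    finally show ?thesis .
  qed
  obtain D' where D': "div_equiv V E D D'" "effective V D'"
    and least: "\<And>D''. div_equiv V E D D'' \<Longrightarrow> effective V D'' \<Longrightarrow> nat (B - P D') \<le> nat (B - P D'')"
    using ex_has_least_nat[of "\<lambda>D'. div_equiv V E D D' \<and> effective V D'" D0 "\<lambda>D'. nat (B - P D')"] D0
    by blast
  have "q \<in> U" if U: "legal V E U D'" for U
  proof (rule ccontr)
    assume q: "q \<notin> U"
    let ?D = "fire_script V E (\<lambda>u. of_bool (u \<in> U)) D'"
    have UV: "U \<subseteq> V" "U \<noteq> {}" using U by (auto simp: legal_def)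
    have eq: "div_equiv V E D ?D" using div_equiv_trans[OF D'(1) div_equiv_fire_set] UV by blast
    have eff: "effective V ?D" by (rule effective_fire_legal[OF U D'(2)])
    have "P ?D = P D' + (\<Sum>u\<in>V. of_bool (u \<in> U) * lap V E p u)"
      unfolding P_def by (rule weighted_degree_fire_script)
    also have "(\<Sum>u\<in>V. of_bool (u \<in> U) * lap V E p u) = (\<Sum>u\<in>U. lap V E p u)"
      using UV(1) by (intro sum.mono_neutral_cong_right) auto
    finally have "P ?D = P D' + (\<Sum>u\<in>U. lap V E p u)" .
    moreover have "(\<Sum>u\<in>U. lap V E p u) > 0"
      using UV q p finite_subset[OF UV(1)] by (intro sum_pos) auto
    \<comment> \<open>\<open>nat\<close> truncates at 0, so \<open>P ?D \<le> B\<close> is what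
      makes the decrease strict.\<close>
    ultimately show False using least[OF eq eff] bound[OF eq eff] by linarith
  qed
  then show ?thesis using that D' by blast
qed

end

section \<open>Enumeration of small edge cuts\<close>

text \<open>Enumerates the complements of all vertex sets with at most \<open>k\<close> boundary edges, by placing the
  vertices one after the other into the set (\<open>I\<close>) or its complement (\<open>W\<close>); \<open>k\<close> is what
  remains of the edge budget.\<close>

fun cutsets :: "('a \<Rightarrow> 'a \<Rightarrow> bool) \<Rightarrow> nat \<Rightarrow> 'a list \<Rightarrow> 'a list \<Rightarrow> 'a list \<Rightarrow> 'a list list" where
  "cutsets E k [] I W = [W]"
| "cutsets E k (x # xs) I W =
    (let c = length (filter (\<lambda>u. E u x) I); d = length (filter (E x) W) in
      (if c \<le> k then cutsets E (k - c) xs I (x # W) else []) @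
      (if d \<le> k then cutsets E (k - d) xs (x # I) W else []))"

lemma sum_of_bool_set:
  "distinct xs \<Longrightarrow> (\<Sum>x\<in>set xs. of_bool (P x)) = (of_nat (length (filter P xs)) :: 'b::semiring_1)"
  by (induction xs) auto

text \<open>On the branch that follows \<open>U\<close>, the edges counted so far all belong to the
  cut of \<open>U\<close>, so the budget is never exceeded and the branch survives.\<close>

lemma cutsets_complete:
  assumes "distinct (xs @ I @ W)" "set I \<subseteq> U" "set W \<inter> U = {}" "U \<subseteq> S" "S = set xs \<union> set I \<union> set W"
    and "(\<Sum>u\<in>U. \<Sum>w\<in>S - U. of_bool (E u w))
           \<le> k + (\<Sum>u\<in>set I. \<Sum>w\<in>set W. of_bool (E u w) :: nat)"
  shows "\<exists>W'\<in>set (cutsets E k xs I W). distinct W' \<and> set W' = S - U"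
  using assms
proof (induction E k xs I W rule: cutsets.induct)
  case (1 E k I W)
  then show ?case by auto
next
  case (2 E k x xs I W)
  define c where "c = length (filter (\<lambda>u. E u x) I)"
  define d where "d = length (filter (E x) W)"
  let ?C = "\<lambda>A B. \<Sum>u\<in>A. \<Sum>w\<in>B. of_bool (E u w) :: nat"
  have finS: "finite S" using 2 by simp
  have finU: "finite U" by (rule finite_subset[OF "2.prems"(4) finS])
  have mono: "?C A B \<le> ?C U (S - U)" if "A \<subseteq> U" "B \<subseteq> S - U" for A B
  proof -
    have "?C A B \<le> ?C A (S - U)"
      using that finS by (intro sum_mono sum_mono2) auto
    also have "\<dots> \<le> ?C U (S - U)"
      using that finU by (intro sum_mono2) auto
    finally show ?thesis .
  qed
  have dI: "distinct I" "distinct W" "x \<notin> set I" "x \<notin> set W" using "2.prems"(1) by auto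
  show ?case
  proof (cases "x \<in> U")
    case False
    have C: "?C (set I) (set (x # W)) = ?C (set I) (set W) + c"
      using dI sum_of_bool_set[OF dI(1), of "\<lambda>u. E u x", where ?'b = nat]
      by (simp add: sum.distrib c_def)
    have "?C (set I) (set (x # W)) \<le> ?C U (S - U)"
      using False "2.prems" by (intro mono) auto
    then have ck: "c \<le> k" using C "2.prems"(6) by linarith
    have "\<exists>W'\<in>set (cutsets E (k - c) xs I (x # W)). distinct W' \<and> set W' = S - U"
      unfolding c_def
    proof (rule "2.IH"(1))
      show "?C U (S - U) \<le> k - length (filter (\<lambda>u. E u x) I) + ?C (set I) (set (x # W))"
        using C "2.prems"(6) ck by (simp add: c_def)
    qed (use "2.prems" False ck in \<open>auto simp: c_def\<close>)
    then show ?thesis using ck by (auto simp: c_def Let_def)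
  next
    case True
    have C: "?C (set (x # I)) (set W) = ?C (set I) (set W) + d"
      using dI sum_of_bool_set[OF dI(2), of "E x", where ?'b = nat] by (simp add: d_def)
    have "?C (set (x # I)) (set W) \<le> ?C U (S - U)"
      using True "2.prems" by (intro mono) auto
    then have dk: "d \<le> k" using C "2.prems"(6) by linarith
    have "\<exists>W'\<in>set (cutsets E (k - d) xs (x # I) W). distinct W' \<and> set W' = S - U"
      unfolding d_def
    proof (rule "2.IH"(2))
      show "?C U (S - U) \<le> k - length (filter (E x) W) + ?C (set (x # I)) (set W)"
        using C "2.prems"(6) dk by (simp add: d_def)
    qed (use "2.prems" True dk in \<open>auto simp: d_def\<close>)
    then show ?thesis using dk by (auto simp: d_def Let_def)
  qed
qed

section \<open>The staircase and its small cuts\<close>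

definition cells :: "(nat \<times> nat) list" where
  "cells = [(1,1), (1,2), (1,3), (1,4), (1,5), (2,1), (2,2), (2,3), (2,4),
            (3,1), (3,2), (3,3), (4,1), (4,2), (5,1)]"

lemma T5_eq_cells: "T5 = set cells"
proof -
  have "T5 = set (filter (\<lambda>(x, y). x + y \<le> 6) (List.product [1..<6] [1..<6]))"
    by (auto simp: T5_def)
  also have "\<dots> = set cells" by code_simp
  finally show ?thesis .
qed

lemmas T5_enum = T5_eq_cells[unfolded cells_def, simplified]

interpretation rook: simple_graph T5 rook_adj
  by unfold_locales (auto simp: T5_eq_cells rook_adj_def)

text \<open>An exhaustive check by evaluation; 9 is the largest degree to exclude, and 12 = 15 -
  3.\<close>

lemma rook_cutsets_sizes:
  "list_all (\<lambda>W. length W \<le> 3 \<or> 12 \<le> length W) (cutsets rook_adj 9 cells [] [])"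
  by code_simp

lemma card_T5: "card T5 = 15"
  by (simp add: T5_enum)

text \<open>Each boundary edge claims its own chip on \<open>U\<close>.\<close>

lemma legal_cut_le_degree:
  assumes "legal T5 rook_adj U D" "effective T5 D"
  shows "(\<Sum>u\<in>U. outdeg T5 rook_adj U u) \<le> div_degree T5 D"
proof -
  have U: "U \<subseteq> T5" using assms by (simp add: legal_def)
  have "(\<Sum>u\<in>U. outdeg T5 rook_adj U u) \<le> (\<Sum>u\<in>U. D u)"
    using assms by (intro sum_mono) (auto simp: legal_def)
  also have "\<dots> \<le> (\<Sum>u\<in>T5. D u)"
    using assms U by (intro sum_mono2) (auto simp: effective_def)
  finally show ?thesis by (simp add: div_degree_def)
qed

lemma small_cut_cases:
  assumes "U \<subseteq> T5" "(\<Sum>u\<in>U. outdeg T5 rook_adj U u) \<le> 9"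
  shows "card U \<le> 3 \<or> card (T5 - U) \<le> 3"
proof -
  have "int (\<Sum>u\<in>U. \<Sum>w\<in>T5 - U. of_bool (rook_adj u w)) \<le> 9"
    using assms(2) by (simp only: outdeg_def of_nat_sum of_nat_of_bool)
  then have "(\<Sum>u\<in>U. \<Sum>w\<in>T5 - U. of_bool (rook_adj u w) :: nat) \<le> 9"
    by linarith
  moreover have "distinct cells" by (simp add: cells_def)
  ultimately obtain W where W: "W \<in> set (cutsets rook_adj 9 cells [] [])" "distinct W" "set W = T5 - U"
    using assms(1) cutsets_complete[of cells "[]" "[]" U T5 rook_adj 9] by (auto simp: T5_eq_cells)
  have "length W \<le> 3 \<or> 12 \<le> length W"
    using rook_cutsets_sizes W(1) by (auto simp: list_all_iff)
  moreover have "length W = card (T5 - U)" using W distinct_card by metis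
  moreover have "card (T5 - U) = 15 - card U"
    using assms(1) finite_subset[OF assms(1)] by (simp add: card_Diff_subset card_T5)
  moreover have "card U \<le> 15" using card_mono[OF _ assms(1)] by (simp add: card_T5)
  ultimately show ?thesis by linarith
qed

section \<open>Divisors whose empty cells are enclosed\<close>

text \<open>The last conjunct is legality of \<open>T5 - W\<close>, stated through the small
  complement \<open>W\<close>.\<close>

definition zeros_enclosed :: "(nat \<times> nat \<Rightarrow> int) \<Rightarrow> bool" where
  "zeros_enclosed D \<longleftrightarrow> (\<forall>v\<in>T5. D v = 0 \<longrightarrow>
     (\<exists>W\<subseteq>T5. v \<in> W \<and> card W \<le> 3 \<and> (\<forall>u\<in>T5 - W. (\<Sum>x\<in>W. of_bool (rook_adj u x)) \<le> D u)))"

lemma zeros_enclosedE: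
  assumes "zeros_enclosed D" "v \<in> T5" "D v = 0"
  obtains W where "W \<subseteq> T5" "v \<in> W" "card W \<le> 3"
    "\<And>u. u \<in> T5 - W \<Longrightarrow> (\<Sum>x\<in>W. of_bool (rook_adj u x)) \<le> D u"
  using assms unfolding zeros_enclosed_def by metis

text \<open>A vertex of the clique \<open>K\<close> outside \<open>W\<close> is adjacent to all of
  \<open>K \<inter> W\<close>, so it carries at least \<open>card (K \<inter> W)\<close>
  chips.\<close>

lemma clique_sum_ge:
  fixes D :: "'a \<Rightarrow> int"
  assumes "finite K" "finite W" "\<And>u x. u \<in> K \<Longrightarrow> x \<in> K \<Longrightarrow> u \<noteq> x \<Longrightarrow> E u x"
    and "\<And>u. u \<in> K \<Longrightarrow> 0 \<le> D u"
    and "\<And>u. u \<in> K - W \<Longrightarrow> (\<Sum>x\<in>W. of_bool (E u x)) \<le> D u"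
  shows "int (card (K \<inter> W)) * (int (card K) - int (card (K \<inter> W))) \<le> (\<Sum>u\<in>K. D u)"
proof -
  have "int (card (K \<inter> W)) \<le> D u" if u: "u \<in> K - W" for u
  proof -
    have "int (card (K \<inter> W)) = (\<Sum>x\<in>K \<inter> W. of_bool (E u x))"
      using assms(3) u by (subst sum.cong[of _ "K \<inter> W" _ "\<lambda>_. 1"]) auto
    also have "\<dots> \<le> (\<Sum>x\<in>W. of_bool (E u x))"
      using assms(2) by (intro sum_mono2) auto
    finally show ?thesis using assms(5)[OF u] by linarith
  qed
  then have "(\<Sum>u\<in>K - W. int (card (K \<inter> W))) \<le> (\<Sum>u\<in>K - W. D u)"
    by (rule sum_mono)
  also have "\<dots> \<le> (\<Sum>u\<in>K. D u)"
    using assms(1,4) by (intro sum_mono2) auto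
  also have "(\<Sum>u\<in>K - W. int (card (K \<inter> W))) = (int (card K) - int (card (K \<inter> W))) * int (card (K \<inter> W))"
    using assms(1) by (simp add: card_Diff_subset_Int card_mono of_nat_diff)
  finally show ?thesis by (simp add: mult.commute)
qed

text \<open>Either no cell of \<open>K\<close> is empty, or the set enclosing an empty cell meets
  the clique \<open>K\<close> in 1 to 3 cells. \<open>W\<close> is passed on because the last bound
  is void when \<open>card K = w = 3\<close>.\<close>

lemma zeros_enclosed_column:
  assumes "zeros_enclosed D" "effective T5 D" "K \<subseteq> T5"
    and column: "\<forall>u\<in>K. fst u = c"
  obtains "int (card K) \<le> (\<Sum>u\<in>K. D u)"
  | W w where "W \<subseteq> T5" "card W \<le> 3" "\<And>u. u \<in> T5 - W \<Longrightarrow> (\<Sum>x\<in>W. of_bool (rook_adj u x)) \<le> D u"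
      "w = card (K \<inter> W)" "w \<in> {1, 2, 3}" "int w * (int (card K) - int w) \<le> (\<Sum>u\<in>K. D u)"
proof (cases "\<exists>v\<in>K. D v = 0")
  case True
  then obtain v W where v: "v \<in> K" and W: "W \<subseteq> T5" "v \<in> W" "card W \<le> 3"
    "\<And>u. u \<in> T5 - W \<Longrightarrow> (\<Sum>x\<in>W. of_bool (rook_adj u x)) \<le> D u"
    using zeros_enclosedE[OF assms(1)] assms(3) by (metis subsetD)
  have fin: "finite K" "finite W" using assms(3) W(1) finite_subset rook.finite_V by blast+
  have "card (K \<inter> W) \<noteq> 0" using v W(2) fin by auto
  moreover have "card (K \<inter> W) \<le> 3" using W(3) card_mono[of W "K \<inter> W"] fin by auto
  moreover have "int (card (K \<inter> W)) * (int (card K) - int (card (K \<inter> W))) \<le> (\<Sum>u\<in>K. D u)"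
  proof (rule clique_sum_ge[OF fin])
    show "rook_adj u x" if "u \<in> K" "x \<in> K" "u \<noteq> x" for u x
      using that column by (simp add: rook_adj_def)
  qed (use assms(2,3) W(4) in \<open>auto simp: effective_def\<close>)
  moreover from calculation(1,2) have "card (K \<inter> W) \<in> {1, 2, 3}" by (simp; linarith)
  ultimately show ?thesis using that(2)[OF W(1,3,4) refl] by blast
next
  case False
  then have "1 \<le> D u" if "u \<in> K" for u
    using assms(2,3) that unfolding effective_def by (metis subsetD int_one_le_iff_zero_less order_le_less)
  then have "(\<Sum>u\<in>K. 1) \<le> (\<Sum>u\<in>K. D u)" by (rule sum_mono)
  then show ?thesis using that(1) by simp
qed

text \<open>For n cells, w(n - w) is n - 1, 2n - 4 or 3n - 9, each at least n - 1 once n is at least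
  4.\<close>

lemma zeros_enclosed_long_column:
  assumes "zeros_enclosed D" "effective T5 D" "K \<subseteq> T5" "\<forall>u\<in>K. fst u = c" "4 \<le> card K"
  shows "int (card K) - 1 \<le> (\<Sum>u\<in>K. D u)"
proof (rule zeros_enclosed_column[OF assms(1-4)])
  fix w assume "w \<in> {1, 2, 3}" "int w * (int (card K) - int w) \<le> (\<Sum>u\<in>K. D u)"
  then show ?thesis using assms(5) by (auto simp: algebra_simps)
qed auto

text \<open>An empty neighbour of \<open>a\<close> must itself lie in the set enclosing
  \<open>a\<close>, so that set is \<open>{a, b, c}\<close> by size.\<close>

lemma zeros_enclosed_triple:
  assumes "zeros_enclosed D" "a \<in> T5" "b \<in> T5" "c \<in> T5" "distinct [a, b, c]"
    and "D a = 0" "D b = 0" "D c = 0" "rook_adj b a" "rook_adj c a" "u \<in> T5 - {a, b, c}"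
  shows "of_bool (rook_adj u a) + of_bool (rook_adj u b) + of_bool (rook_adj u c) \<le> D u"
proof -
  obtain W where W: "W \<subseteq> T5" "a \<in> W" "card W \<le> 3"
    "\<And>u. u \<in> T5 - W \<Longrightarrow> (\<Sum>x\<in>W. of_bool (rook_adj u x)) \<le> D u"
    using zeros_enclosedE[OF assms(1,2,6)] by metis
  have fin: "finite W" using W(1) finite_subset rook.finite_V by blast
  have mem: "x \<in> W" if "x \<in> T5" "D x = 0" "rook_adj x a" for x
  proof (rule ccontr)
    assume "x \<notin> W"
    then have "(\<Sum>y\<in>W. of_bool (rook_adj x y)) \<le> (0 :: int)" using W(4)[of x] that by simp
    moreover have "of_bool (rook_adj x a) \<le> (\<Sum>y\<in>W. of_bool (rook_adj x y) :: int)"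
      using W(2) fin by (intro member_le_sum) auto
    ultimately show False using that(3) by simp
  qed
  have "{a, b, c} \<subseteq> W" using mem assms W(2) by auto
  moreover have "card {a, b, c} = 3" using assms(5) by simp
  ultimately have "W = {a, b, c}" using W(3) fin by (metis card_seteq)
  then show ?thesis using W(4)[of u] assms(5,11) by auto
qed

lemma zeros_enclosed_degree_ge:
  assumes enc: "zeros_enclosed D" and eff: "effective T5 D"
  shows "10 \<le> div_degree T5 D"
proof (rule ccontr)
  assume "\<not> 10 \<le> div_degree T5 D"
  then have total: "(\<Sum>v\<in>T5. D v) \<le> 9" by (simp add: div_degree_def)
  have nonneg: "0 \<le> D v" if "v \<in> T5" for v using eff that by (simp add: effective_def)
  have cell: "0 \<le> D (1,1)" "0 \<le> D (1,2)" "0 \<le> D (1,3)" "0 \<le> D (1,4)" "0 \<le> D (1,5)"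
    "0 \<le> D (2,1)" "0 \<le> D (2,2)" "0 \<le> D (2,3)" "0 \<le> D (2,4)"
    "0 \<le> D (3,1)" "0 \<le> D (3,2)" "0 \<le> D (3,3)" "0 \<le> D (4,1)" "0 \<le> D (4,2)" "0 \<le> D (5,1)"
    by (rule nonneg, simp add: T5_enum)+
  have tot: "D (1,1) + D (1,2) + D (1,3) + D (1,4) + D (1,5) + D (2,1) + D (2,2) + D (2,3) + D (2,4)
    + D (3,1) + D (3,2) + D (3,3) + D (4,1) + D (4,2) + D (5,1) \<le> 9"
    using total by (simp add: T5_enum)
  \<comment> \<open>The three cells demand 2 + 2 + 2 + 1 + 1 + 1 = 9 chips on the first two rows, so
    the rest of the first column is empty; this empty triple demands a third chip on
    \<open>(1,1)\<close>.\<close>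
  have A: False if "D (4,1) = 0" "D (4,2) = 0" "D (5,1) = 0"
  proof -
    note t = zeros_enclosed_triple[OF enc, of "(4,1)" "(4,2)" "(5,1)"]
    have "2 \<le> D (1,1)" "2 \<le> D (2,1)" "2 \<le> D (3,1)" "1 \<le> D (1,2)" "1 \<le> D (2,2)" "1 \<le> D (3,2)"
      using that t[of "(1,1)"] t[of "(2,1)"] t[of "(3,1)"] t[of "(1,2)"] t[of "(2,2)"] t[of "(3,2)"]
      by (simp_all add: T5_enum rook_adj_def)
    moreover from this have "D (1,3) = 0" "D (1,4) = 0" "D (1,5) = 0" using cell tot by linarith+
    then have "3 \<le> D (1,1)"
      using zeros_enclosed_triple[OF enc, of "(1,3)" "(1,4)" "(1,5)" "(1,1)"]
      by (simp add: T5_enum rook_adj_def)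
    ultimately show False using cell tot by linarith
  qed
  \<comment> \<open>The mirror image of \<open>A\<close>; it settles the exceptional case of the
    third column.\<close>
  have A': False if "D (1,4) = 0" "D (2,4) = 0" "D (1,5) = 0"
  proof -
    note t = zeros_enclosed_triple[OF enc, of "(1,4)" "(2,4)" "(1,5)"]
    have "2 \<le> D (1,1)" "2 \<le> D (1,2)" "2 \<le> D (1,3)" "1 \<le> D (2,1)" "1 \<le> D (2,2)" "1 \<le> D (2,3)"
      using that t[of "(1,1)"] t[of "(1,2)"] t[of "(1,3)"] t[of "(2,1)"] t[of "(2,2)"] t[of "(2,3)"]
      by (simp_all add: T5_enum rook_adj_def)
    moreover from this have "D (3,1) = 0" "D (4,1) = 0" "D (5,1) = 0" using cell tot by linarith+
    then have "3 \<le> D (1,1)"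
      using zeros_enclosed_triple[OF enc, of "(3,1)" "(4,1)" "(5,1)" "(1,1)"]
      by (simp add: T5_enum rook_adj_def)
    ultimately show False using cell tot by linarith
  qed
  let ?C1 = "{(1,1), (1,2), (1,3), (1,4), (1,5)} :: (nat \<times> nat) set"
  have C1: "4 \<le> (\<Sum>u\<in>?C1. D u)"
    using zeros_enclosed_long_column[OF enc eff, of ?C1 1] by (simp add: T5_enum)
  let ?C2 = "{(2,1), (2,2), (2,3), (2,4)} :: (nat \<times> nat) set"
  have C2: "3 \<le> (\<Sum>u\<in>?C2. D u)"
    using zeros_enclosed_long_column[OF enc eff, of ?C2 2] by (simp add: T5_enum)
  let ?C3 = "{(3,1), (3,2), (3,3)} :: (nat \<times> nat) set"
  \<comment> \<open>For three cells, w(3 - w) is 2, 2 or 0, so only w = 3 is left. Then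
    \<open>W\<close> is the column itself and its nine neighbours use up all chips, against
    \<open>A'\<close>.\<close>
  have C3: "2 \<le> (\<Sum>u\<in>?C3. D u)"
  proof (rule zeros_enclosed_column[OF enc eff, of ?C3 3])
    fix W w
    assume W: "W \<subseteq> T5" "card W \<le> 3"
      and dem: "\<And>u. u \<in> T5 - W \<Longrightarrow> (\<Sum>x\<in>W. of_bool (rook_adj u x)) \<le> D u"
      and w: "w = card (?C3 \<inter> W)" "w \<in> {1, 2, 3}" "int w * (int (card ?C3) - int w) \<le> (\<Sum>u\<in>?C3. D u)"
    have fin: "finite W" using W(1) finite_subset rook.finite_V by blast
    have card3: "card ?C3 = 3" by simp
    show ?thesis
    proof (cases "w = 3")
      case True
      then have "?C3 \<inter> W = ?C3" using w(1) card3 by (intro card_seteq) auto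
      then have "W = ?C3" using card3 W(2) fin by (metis card_seteq inf.absorb_iff1)
      then have "1 \<le> D (1,1)" "1 \<le> D (2,1)" "1 \<le> D (4,1)" "1 \<le> D (5,1)" "1 \<le> D (1,2)"
        "1 \<le> D (2,2)" "1 \<le> D (4,2)" "1 \<le> D (1,3)" "1 \<le> D (2,3)"
        using dem[of "(1,1)"] dem[of "(2,1)"] dem[of "(4,1)"] dem[of "(5,1)"] dem[of "(1,2)"]
          dem[of "(2,2)"] dem[of "(4,2)"] dem[of "(1,3)"] dem[of "(2,3)"]
        by (simp_all add: T5_enum rook_adj_def)
      then have "D (1,4) = 0" "D (2,4) = 0" "D (1,5) = 0" using cell tot by linarith+
      then show ?thesis using A' by blast
    next
      case False
      then show ?thesis using w(2,3) by auto
    qed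
  qed (simp_all add: T5_enum)
  have cols: "4 \<le> D (1,1) + D (1,2) + D (1,3) + D (1,4) + D (1,5)"
    "3 \<le> D (2,1) + D (2,2) + D (2,3) + D (2,4)" "2 \<le> D (3,1) + D (3,2) + D (3,3)"
    using C1 C2 C3 by simp_all
  \<comment> \<open>4 + 3 + 2 already reaches 9, so nothing is left for the last two
    columns.\<close>
  have "D (4,1) = 0" "D (4,2) = 0" "D (5,1) = 0"
    using cols tot cell by linarith+
  then show False by (rule A)
qed

section \<open>From reduced divisors to the lower bound\<close>

text \<open>Some legal set avoids the empty \<open>v\<close>; its boundary has at most 9 edges, and
  as it is not small, its complement is.\<close>

lemma zeros_enclosed_if_no_small_legal:
  assumes "positive_rank T5 rook_adj D" "div_equiv T5 rook_adj D D'" "effective T5 D'"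
    and "div_degree T5 D' \<le> 9" "\<And>U. legal T5 rook_adj U D' \<Longrightarrow> 3 < card U"
  shows "zeros_enclosed D'"
  unfolding zeros_enclosed_def
proof (intro ballI impI)
  fix v assume v: "v \<in> T5" "D' v = 0"
  obtain U where U: "legal T5 rook_adj U D'" "v \<notin> U"
    using rook.positive_rank_imp_legal[OF assms(1,2) v(1)] v(2) by auto
  have UT: "U \<subseteq> T5" using U(1) by (simp add: legal_def)
  have "card (T5 - U) \<le> 3"
    using small_cut_cases[OF UT] legal_cut_le_degree[OF U(1) assms(3)] assms(4) assms(5)[OF U(1)]
    by fastforce
  moreover have "\<forall>u\<in>T5 - (T5 - U). (\<Sum>x\<in>T5 - U. of_bool (rook_adj u x)) \<le> D' u"
    using U(1) unfolding legal_def outdeg_def by blast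
  ultimately show "\<exists>W\<subseteq>T5. v \<in> W \<and> card W \<le> 3 \<and>
      (\<forall>u\<in>T5 - W. (\<Sum>x\<in>W. of_bool (rook_adj u x)) \<le> D' u)"
    using U(2) v(1) by (intro exI[of _ "T5 - U"]) blast
qed

lemma int_card_remove: "finite U \<Longrightarrow> u \<in> U \<Longrightarrow> int (card (U - {u})) = int (card U) - 1"
  by (drule (1) card_Suc_Diff1) linarith

text \<open>Column and row of \<open>(x, y)\<close> have 6 - x and 6 - y cells, and the cell itself
  is counted in neither.\<close>

lemma rook_degree: "\<forall>u\<in>T5. (\<Sum>x\<in>T5. of_bool (rook_adj u x)) = 10 - int (fst u) - int (snd u)"
  unfolding T5_enum by (intro ballI, elim insertE emptyE; simp add: rook_adj_def)

lemma outdeg_ge: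
  assumes "U \<subseteq> T5" "u \<in> U"
  shows "10 - int (fst u) - int (snd u) - (int (card U) - 1) \<le> outdeg T5 rook_adj U u"
proof -
  have fin: "finite U" using assms(1) finite_subset rook.finite_V by blast
  have "(\<Sum>x\<in>T5. of_bool (rook_adj u x)) = 10 - int (fst u) - int (snd u)"
    using assms rook_degree by blast
  moreover have "(\<Sum>x\<in>T5. of_bool (rook_adj u x)) =
      outdeg T5 rook_adj U u + (\<Sum>x\<in>U. of_bool (rook_adj u x))"
    unfolding outdeg_def by (rule sum.subset_diff[OF assms(1)]) simp
  moreover have "(\<Sum>x\<in>U. of_bool (rook_adj u x)) = (\<Sum>x\<in>U - {u}. of_bool (rook_adj u x) :: int)"
    using assms(2) fin by (simp add: sum.remove)
  moreover have "(\<Sum>x\<in>U - {u}. of_bool (rook_adj u x) :: int) \<le> (\<Sum>x\<in>U - {u}. 1)"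
    by (rule sum_mono) simp
  moreover have "(\<Sum>x\<in>U - {u}. 1) = int (card U) - 1"
    using assms(2) fin by (simp add: int_card_remove del: card_Diff_insert card_Diff_singleton)
  ultimately show ?thesis by linarith
qed

text \<open>Degrees are at least 4, with equality on \<open>x + y = 6\<close>.\<close>

lemma outdeg_ge_hypotenuse:
  assumes "U \<subseteq> T5" "u \<in> U"
  shows "5 - int (card U) \<le> outdeg T5 rook_adj U u"
proof -
  have "fst u + snd u \<le> 6" using assms by (auto simp: T5_def)
  then show ?thesis using outdeg_ge[OF assms] by linarith
qed

lemma positive_rank_degree_ge:
  assumes "positive_rank T5 rook_adj D"
  shows "10 \<le> div_degree T5 D"
proof (rule ccontr)
  assume "\<not> 10 \<le> div_degree T5 D"
  then have deg: "div_degree T5 D \<le> 9" by simp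
  let ?q = "(1, 1) :: nat \<times> nat"
  have q: "?q \<in> T5" by (simp add: T5_def)
  obtain D0 where D0: "div_equiv T5 rook_adj D D0" "effective T5 D0"
    using assms q unfolding positive_rank_def by blast
  \<comment> \<open>5 is the least integer weight that works: on the first row and column, 5 - 1
    from \<open>?q\<close> must beat up to 3 neighbours of weight 0. Every other cell sees two
    neighbours of weight 1.\<close>
  define p :: "nat \<times> nat \<Rightarrow> int" where
    "p u = (if u = ?q then 5 else if fst u = 1 \<or> snd u = 1 then 1 else 0)" for u
  have "\<forall>u\<in>T5. u \<noteq> ?q \<longrightarrow> lap T5 rook_adj p u > 0"
    unfolding T5_enum by (intro ballI, elim insertE emptyE; simp add: lap_def rook_adj_def p_def)
  then have p: "lap T5 rook_adj p u > 0" if "u \<in> T5" "u \<noteq> ?q" for u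
    using that by blast
  obtain D1 where D1: "div_equiv T5 rook_adj D D1" "effective T5 D1"
    and red: "\<And>U. legal T5 rook_adj U D1 \<Longrightarrow> ?q \<in> U"
    using rook.ex_reduced[OF D0 p] by blast
  have deg1: "div_degree T5 D1 \<le> 9" using rook.degree_div_equiv[OF D1(1)] deg by simp
  show False
  proof (cases "D1 ?q < 8")
    case True
    \<comment> \<open>A singleton would need 8 chips on \<open>?q\<close>; for 2 or 3 cells the
      outdegrees add up to at least 7 + 3 or 6 + 2 * 2, both 10.\<close>
    have "3 < card U" if U: "legal T5 rook_adj U D1" for U
    proof (rule ccontr)
      assume c: "\<not> 3 < card U"
      have UT: "U \<subseteq> T5" using U by (simp add: legal_def)
      have fin: "finite U" using UT finite_subset rook.finite_V by blast
      have qU: "?q \<in> U" by (rule red[OF U])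
      have oq: "9 - int (card U) \<le> outdeg T5 rook_adj U ?q" using outdeg_ge[OF UT qU] by simp
      have "outdeg T5 rook_adj U ?q \<le> D1 ?q" using U qU by (simp add: legal_def)
      then have c1: "card U \<noteq> 1" using True oq by auto
      have c0: "card U \<noteq> 0" using qU fin by auto
      have "(\<Sum>u\<in>U - {?q}. 5 - int (card U)) \<le> (\<Sum>u\<in>U - {?q}. outdeg T5 rook_adj U u)"
        using outdeg_ge_hypotenuse[OF UT] by (intro sum_mono) auto
      then have "(int (card U) - 1) * (5 - int (card U)) \<le> (\<Sum>u\<in>U - {?q}. outdeg T5 rook_adj U u)"
        using qU fin by (simp add: int_card_remove del: card_Diff_insert card_Diff_singleton)
      moreover have "(\<Sum>u\<in>U. outdeg T5 rook_adj U u)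
          = outdeg T5 rook_adj U ?q + (\<Sum>u\<in>U - {?q}. outdeg T5 rook_adj U u)"
        using fin qU by (rule sum.remove)
      moreover have "(\<Sum>u\<in>U. outdeg T5 rook_adj U u) \<le> 9"
        using legal_cut_le_degree[OF U D1(2)] deg1 by linarith
      moreover have "card U = 2 \<or> card U = 3" using c c0 c1 by linarith
      ultimately show False using oq by auto
    qed
    then show False
      using zeros_enclosed_degree_ge[OF zeros_enclosed_if_no_small_legal[OF assms D1 deg1]] D1(2) deg1
      by force
  next
    case False
    define D2 where "D2 = fire T5 rook_adj ?q D1"
    \<comment> \<open>What \<open>D1\<close> keeps when \<open>?q\<close> fires, without the chips
      received by the neighbours; its degree is at most 9 - 8 = 1.\<close>
    define R where "R = (\<lambda>u. if u = ?q then D1 u - 8 else D1 u)"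
    have "int (vdeg T5 rook_adj ?q) = (\<Sum>x\<in>T5. of_bool (rook_adj ?q x))"
      by (simp add: vdeg_def sum_of_bool_eq Int_def)
    then have "vdeg T5 rook_adj ?q = 8" using rook_degree q by force
    then have D2: "D2 u = R u + of_bool (rook_adj ?q u)" if "u \<in> T5" for u
      using that by (auto simp: D2_def R_def fire_def rook_adj_def)
    have R0: "0 \<le> R u" if "u \<in> T5" for u
      using that False D1(2) by (auto simp: R_def effective_def)
    have "(\<Sum>u\<in>T5. R u) = (\<Sum>u\<in>T5. D1 u - (if u = ?q then 8 else 0))"
      by (rule sum.cong) (auto simp: R_def)
    also have "\<dots> = div_degree T5 D1 - 8"
      using q by (simp add: sum_subtractf div_degree_def)
    finally have R1: "(\<Sum>u\<in>T5. R u) \<le> 1" using deg1 by linarith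
    have eff2: "effective T5 D2" using D2 R0 by (auto simp: effective_def)
    have eq2: "div_equiv T5 rook_adj D D2"
      unfolding D2_def using D1(1) q by (rule rook.div_equiv_fire)
    have deg2: "div_degree T5 D2 \<le> 9" using rook.degree_div_equiv[OF eq2] deg by simp
    have "3 < card U" if U: "legal T5 rook_adj U D2" for U
    proof (rule ccontr)
      assume c: "\<not> 3 < card U"
      have UT: "U \<subseteq> T5" using U by (simp add: legal_def)
      have fin: "finite U" using UT finite_subset rook.finite_V by blast
      \<comment> \<open>At most one chip of \<open>D2 u\<close> came from \<open>?q\<close>, hence 4
        in place of 5. Summed over 1, 2 or 3 cells this is 3, 4 or 3, above the degree of
        \<open>R\<close>.\<close>
      have "4 - int (card U) \<le> R u" if u: "u \<in> U" for u
      proof -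
        have "5 - int (card U) \<le> D2 u"
          using outdeg_ge_hypotenuse[OF UT u] U u by (fastforce simp: legal_def)
        moreover have "D2 u \<le> R u + 1" using D2[of u] u UT by auto
        ultimately show ?thesis by linarith
      qed
      then have "(\<Sum>u\<in>U. 4 - int (card U)) \<le> (\<Sum>u\<in>U. R u)" by (rule sum_mono)
      also have "\<dots> \<le> (\<Sum>u\<in>T5. R u)" using UT R0 by (intro sum_mono2) auto
      finally have "int (card U) * (4 - int (card U)) \<le> 1" using R1 by simp
      moreover have "card U \<noteq> 0" using U fin by (simp add: legal_def)
      then have "card U = 1 \<or> card U = 2 \<or> card U = 3" using c by linarith
      ultimately show False by auto
    qed
    then show False
      using zeros_enclosed_degree_ge[OF zeros_enclosed_if_no_small_legal[OF assms eq2 eff2 deg2]] eff2 deg2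
      by force
  qed
qed

section \<open>A divisor of degree 10 with positive rank\<close>

text \<open>The bounds on \<open>snd u\<close> make it vanish off \<open>T5\<close>, as
  \<open>is_divisor\<close> demands.\<close>

definition staircase_divisor :: "nat \<times> nat \<Rightarrow> int" where
  "staircase_divisor u = (if fst u = 1 \<and> 1 \<le> snd u \<and> snd u \<le> 5 then 5 - int (snd u) else 0)"

text \<open>A cell \<open>(1, y)\<close> has 5 - y neighbours off the first column, exactly its
  chips, and every other cell has one neighbour in that column.\<close>

lemma fire_first_column:
  "\<forall>u\<in>set cells. fire_script (set cells) rook_adj
     (\<lambda>u. of_bool (u \<in> set (filter (\<lambda>u. fst u = 1) cells))) staircase_divisor u = of_bool (fst u \<noteq> 1)"
  by code_simp

text \<open>\<open>(1,5)\<close> is alone in its row, so only the other four cells of its column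
  pay, one chip each.\<close>

lemma fire_all_but_corner:
  "\<forall>u\<in>set cells. fire_script (set cells) rook_adj
     (\<lambda>u. of_bool (u \<in> set (filter (\<lambda>u. u \<noteq> (1,5)) cells))) staircase_divisor u
     = (if u = (1,5) then 4 else if fst u = 1 then 4 - int (snd u) else 0)"
  by code_simp

lemma ex_positive_rank_degree_10:
  "\<exists>D. is_divisor T5 D \<and> div_degree T5 D = 10 \<and> positive_rank T5 rook_adj D"
proof -
  let ?D = staircase_divisor
  let ?f = "\<lambda>U. fire_script T5 rook_adj (\<lambda>u. of_bool (u \<in> U)) ?D"
  let ?A = "set (filter (\<lambda>u. fst u = 1) cells)"
  let ?B = "set (filter (\<lambda>u. u \<noteq> (1,5)) cells)"
  have eq: "div_equiv T5 rook_adj ?D (?f ?A)" "div_equiv T5 rook_adj ?D (?f ?B)"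
    by (rule rook.div_equiv_fire_set; simp only: T5_eq_cells filter_is_subset)+
  have A: "?f ?A u = of_bool (fst u \<noteq> 1)" if "u \<in> T5" for u
    using bspec[OF fire_first_column] that by (simp only: T5_eq_cells)
  have B: "?f ?B u = (if u = (1,5) then 4 else if fst u = 1 then 4 - int (snd u) else 0)"
    if "u \<in> T5" for u
    using bspec[OF fire_all_but_corner] that by (simp only: T5_eq_cells)
  have eff: "effective T5 ?D" "effective T5 (?f ?A)" "effective T5 (?f ?B)"
  proof -
    have "0 \<le> ?f ?B u" if "u \<in> T5" for u
    proof -
      have "snd u \<le> 4" if "fst u = 1" "u \<noteq> (1,5)"
        using \<open>u \<in> T5\<close> that by (cases u) (auto simp: T5_def)
      then show ?thesis unfolding B[OF that] by auto
    qed
    then show "effective T5 (?f ?B)" unfolding effective_def by blast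
    have "0 \<le> ?f ?A u" if "u \<in> T5" for u
      unfolding A[OF that] by simp
    then show "effective T5 (?f ?A)" unfolding effective_def by blast
  qed (auto simp: effective_def staircase_divisor_def)
  have "positive_rank T5 rook_adj ?D"
    unfolding positive_rank_def
  proof
    fix v assume v: "v \<in> T5"
    \<comment> \<open>\<open>(1,5)\<close> is the only empty cell of the first column; it and the
      cells off that column each get their own firing.\<close>
    consider "v = (1,5)" | "fst v \<noteq> 1" | "fst v = 1" "v \<noteq> (1,5)" by blast
    then show "\<exists>D'. div_equiv T5 rook_adj ?D D' \<and> effective T5 D' \<and> 0 < D' v"
    proof cases
      case 1
      then show ?thesis using eq(2) eff(3) B[OF v] by (intro exI[of _ "?f ?B"]) (simp del: set_filter)
    next
      case 2
      then show ?thesis using eq(1) eff(2) A[OF v] by (intro exI[of _ "?f ?A"]) (simp del: set_filter)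
    next
      case 3
      then have "0 < ?D v" using v by (cases v) (auto simp: staircase_divisor_def T5_def)
      then show ?thesis using eff(1) by (intro exI[of _ ?D]) (auto simp: div_equiv_def)
    qed
  qed
  moreover have "is_divisor T5 ?D" by (auto simp: is_divisor_def staircase_divisor_def T5_def)
  moreover have "div_degree T5 ?D = 10" by (simp add: div_degree_def staircase_divisor_def T5_enum)
  ultimately show ?thesis by blast
qed

theorem theorem4p5:
  shows "gonality T5 rook_adj = 10"
  unfolding gonality_def
  using ex_positive_rank_degree_10 positive_rank_degree_ge by (intro Least_equality) auto

end
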